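(* For every integer $n\ge1$, the set of totally symmetric self-complementary plane partitions inside a $2n\times2n\times2n$ box is in bijection with the set of tournaments on the vertex set $\{1,2,\dots,n\}$ satisfying the following condition: for all $1\le u<v\le n$, if vertex $v$ has exactly $k$ upsets with vertices in $\{u,u+1,\dots,v-1\}$, then vertex $v-1$ has at most $k$ upsets with vertices in $\{u,u+1,\dots,v-2\}$.
   Context: A tournament on $\{1,\dots,n\}$ is an assignment, for each pair $i<j$, of a winner in $\{i,j\}$. The game between $i<j$ is an upset if $j$ wins. The number of upsets of vertex $v$ with vertices in a set $W$ is the number of $w\in W$ such that the game between $v$ and $w$ is an upset. A plane partition inside a $2n\times2n\times2n$ box is a set $\pi\subseteq\{1,\dots,2n\}^3$ such that $(i,j,k)\in\pi$ and $i'\le i,j'\le j,k'\le k$ (positive integers) imply $(i',j',k')\in\pi$; it is totally symmetric if invariant under all permutations of coordinates, and self-complementary if $(i,j,k)\in\pi\iff(2n+1-i,2n+1-j,2n+1-k)\notin\pi$ for all $(i,j,k)\in\{1,\dots,2n\}^3$. *)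

theory Defs
  imports "HOL-Library.FuncSet"
begin

definition plane_partition_in_box :: "nat \<Rightarrow> (nat \<times> nat \<times> nat) set \<Rightarrow> bool" where
  "plane_partition_in_box n \<pi> \<longleftrightarrow>
     \<pi> \<subseteq> {1..2*n} \<times> {1..2*n} \<times> {1..2*n} \<and>
     (\<forall>i j k i' j' k'. (i, j, k) \<in> \<pi> \<longrightarrow>
        1 \<le> i' \<and> i' \<le> i \<longrightarrow> 1 \<le> j' \<and> j' \<le> j \<longrightarrow> 1 \<le> k' \<and> k' \<le> k \<longrightarrow>
        (i', j', k') \<in> \<pi>)"

definition totally_symmetric :: "(nat \<times> nat \<times> nat) set \<Rightarrow> bool" where
  "totally_symmetric \<pi> \<longleftrightarrow>
     (\<forall>i j k. (i, j, k) \<in> \<pi> \<longrightarrow>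
        (i, k, j) \<in> \<pi> \<and> (j, i, k) \<in> \<pi> \<and> (j, k, i) \<in> \<pi> \<and> (k, i, j) \<in> \<pi> \<and> (k, j, i) \<in> \<pi>)"

definition self_complementary :: "nat \<Rightarrow> (nat \<times> nat \<times> nat) set \<Rightarrow> bool" where
  "self_complementary n \<pi> \<longleftrightarrow>
     (\<forall>i \<in> {1..2*n}. \<forall>j \<in> {1..2*n}. \<forall>k \<in> {1..2*n}.
        (i, j, k) \<in> \<pi> \<longleftrightarrow> (2*n + 1 - i, 2*n + 1 - j, 2*n + 1 - k) \<notin> \<pi>)"

definition TSSCPP :: "nat \<Rightarrow> (nat \<times> nat \<times> nat) set set" where
  "TSSCPP n = {\<pi>. plane_partition_in_box n \<pi> \<and> totally_symmetric \<pi> \<and> self_complementary n \<pi>}"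

text \<open>A tournament maps each pair $(i,j)$ with $1 \le i < j \le n$ to the winner of the game
  between $i$ and $j$. It is \<^const>\<open>undefined\<close> on all other pairs, so that different functions
  are different tournaments.\<close>

definition tournaments :: "nat \<Rightarrow> (nat \<times> nat \<Rightarrow> nat) set" where
  "tournaments n = (\<Pi>\<^sub>E (i, j) \<in> {(i, j). 1 \<le> i \<and> i < j \<and> j \<le> n}. {i, j})"

definition upset :: "(nat \<times> nat \<Rightarrow> nat) \<Rightarrow> nat \<Rightarrow> nat \<Rightarrow> bool" where
  "upset T v w \<longleftrightarrow> v \<noteq> w \<and> T (min v w, max v w) = max v w"

definition num_upsets :: "(nat \<times> nat \<Rightarrow> nat) \<Rightarrow> nat \<Rightarrow> nat set \<Rightarrow> nat" where
  "num_upsets T v W = card {w \<in> W. upset T v w}"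

end

theory Submission
  imports Defs
begin

text \<open>Call a coordinate large if it exceeds \<open>n\<close>. By symmetry and self-complementarity a TSSCPP
  contains every point with no large coordinate and none with three, and it is determined by its
  points with exactly two. In the slice at height \<open>n + 1 - v\<close>, let \<open>d u v\<close> be the number of points
  \<open>(n + s, n + s + u - 1)\<close>, \<open>s \<ge> 1\<close>, on the diagonal with offset \<open>u - 1\<close>. The order ideal condition
  says precisely that \<open>d u v\<close> exceeds \<open>d (u + 1) v\<close> by 0 or 1 and is weakly increasing in \<open>v\<close>, and
  self-complementarity forces \<open>d v v = 0\<close>. Letting \<open>v\<close> upset \<open>u\<close> exactly when
  \<open>d (u + 1) v < d u v\<close> makes \<open>d u v\<close> the number of upsets of \<open>v\<close> with vertices in \<open>{u..v - 1}\<close>,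
  so that monotonicity in \<open>v\<close> becomes the condition on the tournament.\<close>

section \<open>Encodings of partitions and tournaments by arrays\<close>

definition centre_dist :: "nat \<Rightarrow> nat \<Rightarrow> nat" where
  "centre_dist n i = (if i \<le> n then n + 1 - i else i - n)"

text \<open>The index \<open>u\<close> runs beyond \<open>v\<close>, so the step conditions need no
  boundary case. Entries with \<open>u = 0\<close> or \<open>v\<close> outside \<open>{1..n}\<close>
  are left free.\<close>

definition diagonal_array :: "nat \<Rightarrow> (nat \<Rightarrow> nat \<Rightarrow> nat) \<Rightarrow> bool" where
  "diagonal_array n d \<longleftrightarrow>
     (\<forall>u v. 1 \<le> u \<and> 1 \<le> v \<and> v \<le> n \<longrightarrow>
        d (Suc u) v \<le> d u v \<and> d u v \<le> Suc (d (Suc u) v) \<and> (v \<le> u \<longrightarrow> d u v = 0) \<and>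
        (Suc v \<le> n \<longrightarrow> d u v \<le> d u (Suc v)))"

text \<open>Counting gives 0 for an empty diagonal; for an order ideal the count is also the last
  index that occurs.\<close>

definition diagonal_length :: "nat \<Rightarrow> (nat \<times> nat \<times> nat) set \<Rightarrow> nat \<Rightarrow> nat \<Rightarrow> nat" where
  "diagonal_length n \<pi> u v = card {s \<in> {1..n}. (n + s, n + s + (u - 1), n + 1 - v) \<in> \<pi>}"

text \<open>For large coordinates \<open>n + x\<close> and \<open>n + y\<close>, this is membership of
  \<open>(n + x, n + y, n + 1 - v)\<close> in the partition: the point is the \<open>min x y\<close>-th one on its diagonal.\<close>

definition below :: "(nat \<Rightarrow> nat \<Rightarrow> nat) \<Rightarrow> nat \<Rightarrow> nat \<Rightarrow> nat \<Rightarrow> bool" where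
  "below d x y v \<longleftrightarrow> min x y \<le> d (Suc (max x y - min x y)) v"

text \<open>Complementation preserves \<^const>\<open>centre_dist\<close> and exchanges small and large coordinates, so a
  point with one large coordinate is a member iff the point with two large coordinates and the same
  distances is not.\<close>

definition partition_of :: "nat \<Rightarrow> (nat \<Rightarrow> nat \<Rightarrow> nat) \<Rightarrow> (nat \<times> nat \<times> nat) set" where
  "partition_of n d = {(i, j, k). i \<in> {1..2*n} \<and> j \<in> {1..2*n} \<and> k \<in> {1..2*n} \<and>
     (let x = centre_dist n i; y = centre_dist n j; z = centre_dist n k in
      if i \<le> n then
        if j \<le> n then k \<le> n \<or> \<not> below d x y z
        else if k \<le> n then \<not> below d x z y else below d y z x
      else
        if j \<le> n then if k \<le> n then \<not> below d y z x else below d x z y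
        else k \<le> n \<and> below d x y z)}"

definition tournament_of :: "nat \<Rightarrow> (nat \<Rightarrow> nat \<Rightarrow> nat) \<Rightarrow> nat \<times> nat \<Rightarrow> nat" where
  "tournament_of n d =
     (\<lambda>(i, j) \<in> {(i, j). 1 \<le> i \<and> i < j \<and> j \<le> n}. if d (Suc i) j < d i j then j else i)"

definition monotone_upsets :: "nat \<Rightarrow> (nat \<times> nat \<Rightarrow> nat) \<Rightarrow> bool" where
  "monotone_upsets n T \<longleftrightarrow>
     (\<forall>u v k. 1 \<le> u \<and> u < v \<and> v \<le> n \<longrightarrow>
        num_upsets T v {u..v - 1} = k \<longrightarrow> num_upsets T (v - 1) {u..v - 2} \<le> k)"

section \<open>From diagonal arrays to partitions\<close>

lemma centre_dist_bounds: "i \<in> {1..2*n} \<Longrightarrow> 1 \<le> centre_dist n i \<and> centre_dist n i \<le> n"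
  by (auto simp: centre_dist_def)

lemma centre_dist_complement: "i \<in> {1..2*n} \<Longrightarrow> centre_dist n (2*n + 1 - i) = centre_dist n i"
  by (auto simp: centre_dist_def)

lemma below_commute: "below d x y v = below d y x v"
  by (simp add: below_def min.commute max.commute)

context
  fixes n :: nat and d :: "nat \<Rightarrow> nat \<Rightarrow> nat"
  assumes d: "diagonal_array n d"
begin

lemma diagonal_array_step: "1 \<le> u \<Longrightarrow> 1 \<le> v \<Longrightarrow> v \<le> n \<Longrightarrow> d (Suc u) v \<le> d u v \<and> d u v \<le> Suc (d (Suc u) v)"
  using d by (simp add: diagonal_array_def)

lemma diagonal_array_zero: "1 \<le> v \<Longrightarrow> v \<le> n \<Longrightarrow> v \<le> u \<Longrightarrow> d u v = 0"
  using d by (simp add: diagonal_array_def)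

text \<open>Starting from \<open>d v v = 0\<close>, each decrease of \<open>u\<close> by one adds at
  most 1.\<close>

lemma diagonal_array_le:
  assumes "1 \<le> v" "v \<le> n" "u \<le> v" "1 \<le> u"
  shows "d u v \<le> v - u"
  using assms(3,4)
proof (induction u rule: inc_induct)
  case base
  then show ?case using diagonal_array_zero assms by simp
next
  case (step m)
  then have "d m v \<le> Suc (d (Suc m) v)" using diagonal_array_step assms by simp
  with step show ?case by simp
qed

lemma diagonal_array_mono_right:
  assumes "v \<le> v'" "1 \<le> v" "v' \<le> n" "1 \<le> u"
  shows "d u v \<le> d u v'"
  using assms(1,3)
proof (induction v' rule: dec_induct)
  case (step m)
  then have "d u m \<le> d u (Suc m)" using d assms by (simp add: diagonal_array_def)
  with step show ?case by simp
qed simp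

lemma below_mono_right: "below d x y v \<Longrightarrow> v \<le> v' \<Longrightarrow> 1 \<le> v \<Longrightarrow> v' \<le> n \<Longrightarrow> below d x y v'"
  unfolding below_def using diagonal_array_mono_right[of v v' "Suc (max x y - min x y)"] by simp

text \<open>For \<open>y \<le> x\<close> the minimum stays and the offset shrinks, so the diagonal
  is no shorter. Otherwise the minimum drops by one and the offset grows by one, which costs the
  diagonal at most one point.\<close>

lemma below_step:
  assumes "below d (Suc x) y v" "1 \<le> v" "v \<le> n"
  shows "below d x y v"
proof (cases "y \<le> x")
  case True
  then show ?thesis
    using assms diagonal_array_step[of "Suc (x - y)" v]
    by (auto simp: below_def Suc_diff_le min_def max_def split: if_splits)
next
  case False
  then have "Suc (y - Suc x) = y - x" "1 \<le> y - x" by auto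
  then show ?thesis
    using False assms diagonal_array_step[of "y - x" v] by (simp add: below_def min_def max_def split: if_splits)
qed

lemma below_mono_left:
  assumes "x \<le> x'" "below d x' y v" "1 \<le> v" "v \<le> n"
  shows "below d x y v"
  using assms(1,2) by (induction x rule: inc_induct) (use below_step assms in auto)

text \<open>By \<open>diagonal_array_le\<close>, the minimum is at most \<open>v - 1\<close> minus
  the offset \<open>max x y - min x y\<close>; adding the offset bounds the maximum.\<close>

lemma below_less:
  assumes "below d x y v" "1 \<le> v" "v \<le> n" "1 \<le> x" "1 \<le> y"
  shows "x < v" "y < v"
proof -
  have "max x y < v"
  proof (cases "Suc (max x y - min x y) \<le> v")
    case True
    then show ?thesis
      using assms diagonal_array_le[of v "Suc (max x y - min x y)"] unfolding below_def by linarith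
  next
    case False
    then show ?thesis
      using assms diagonal_array_zero[of v "Suc (max x y - min x y)"] unfolding below_def by simp
  qed
  then show "x < v" "y < v" by auto
qed

text \<open>These two transpositions generate all permutations of the coordinates.\<close>

lemma partition_of_symmetric:
  assumes "(i, j, k) \<in> partition_of n d"
  shows "(i, k, j) \<in> partition_of n d" "(j, i, k) \<in> partition_of n d"
  using assms by (auto simp: partition_of_def Let_def below_commute split: if_splits)

lemma partition_of_down:
  assumes "(i, j, k) \<in> partition_of n d" "1 \<le> i'" "i' \<le> i"
  shows "(i', j, k) \<in> partition_of n d"
proof -
  define x y z x' where
    xyz: "x = centre_dist n i" "y = centre_dist n j" "z = centre_dist n k" "x' = centre_dist n i'"
  have box: "i \<in> {1..2*n}" "j \<in> {1..2*n}" "k \<in> {1..2*n}" "i' \<in> {1..2*n}"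
    using assms by (auto simp: partition_of_def)
  have b: "1 \<le> x" "x \<le> n" "1 \<le> y" "y \<le> n" "1 \<le> z" "z \<le> n" "1 \<le> x'" "x' \<le> n"
    unfolding xyz using box centre_dist_bounds by auto
  have P: "if i \<le> n then
        if j \<le> n then k \<le> n \<or> \<not> below d x y z
        else if k \<le> n then \<not> below d x z y else below d y z x
      else
        if j \<le> n then if k \<le> n then \<not> below d y z x else below d x z y
        else k \<le> n \<and> below d x y z"
    using assms(1) by (simp add: partition_of_def Let_def xyz)
  have "if i' \<le> n then
        if j \<le> n then k \<le> n \<or> \<not> below d x' y z
        else if k \<le> n then \<not> below d x' z y else below d y z x'
      else
        if j \<le> n then if k \<le> n then \<not> below d y z x' else below d x' z y
        else k \<le> n \<and> below d x' y z"
  \<comment> \<open>On one side of the centre, monotonicity of \<open>below\<close> suffices: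
    lowering a coordinate raises its distance on the small side and reduces it on the large
    side.\<close>
  proof (cases "i \<le> n")
    case True
    then have "i' \<le> n" "x \<le> x'" using assms(3) by (auto simp: xyz centre_dist_def)
    then show ?thesis
      using True P b below_mono_left[of x x'] below_mono_right[of y z x x'] by (auto split: if_splits)
  next
    case large: False
    show ?thesis
    proof (cases "i' \<le> n")
      case True
      \<comment> \<open>The two instances of \<^const>\<open>below\<close> exclude each other, since they would give both
        \<open>y < z\<close> and \<open>z < y\<close>.\<close>
      then show ?thesis
        using large P b below_less[of x y z] below_less[of x z y] below_less[of x' y z]
          below_less[of x' z y] below_less[of y z x] below_less[of y z x']
        by (smt (verit, best) not_less_iff_gr_or_eq)
    next
      case False
      then have "x' \<le> x" using assms(3) large by (auto simp: xyz centre_dist_def)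
      then show ?thesis
        using large False P b below_mono_left[of x' x] below_mono_right[of y z x' x]
        by (auto split: if_splits)
    qed
  qed
  then show ?thesis
    using box unfolding partition_of_def Let_def xyz mem_Collect_eq prod.case by (intro conjI)
qed

lemma partition_of_TSSCPP: "partition_of n d \<in> TSSCPP n"
proof -
  let ?P = "partition_of n d"
  have "plane_partition_in_box n ?P"
    unfolding plane_partition_in_box_def
  proof (intro conjI allI impI)
    show "?P \<subseteq> {1..2*n} \<times> {1..2*n} \<times> {1..2*n}" by (auto simp: partition_of_def)
    fix i j k i' j' k'
    assume "(i, j, k) \<in> ?P" "1 \<le> i' \<and> i' \<le> i" "1 \<le> j' \<and> j' \<le> j" "1 \<le> k' \<and> k' \<le> k"
    \<comment> \<open>Each coordinate in turn is permuted to the front and lowered.\<close>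
    then show "(i', j', k') \<in> ?P"
      by (meson partition_of_symmetric partition_of_down)
  qed
  moreover have "totally_symmetric ?P"
    unfolding totally_symmetric_def by (meson partition_of_symmetric)
  moreover have "self_complementary n ?P"
    unfolding self_complementary_def
  proof (intro ballI)
    fix i j k
    assume box: "i \<in> {1..2*n}" "j \<in> {1..2*n}" "k \<in> {1..2*n}"
    have flip: "2*n + 1 - l \<in> {1..2*n}" "2*n + 1 - l \<le> n \<longleftrightarrow> \<not> l \<le> n" if "l \<in> {1..2*n}" for l
      using that by auto
    show "(i, j, k) \<in> ?P \<longleftrightarrow> (2*n + 1 - i, 2*n + 1 - j, 2*n + 1 - k) \<notin> ?P"
      unfolding partition_of_def Let_def mem_Collect_eq prod.case
      by (cases "i \<le> n"; cases "j \<le> n"; cases "k \<le> n")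
        (simp_all only: box flip centre_dist_complement simp_thms if_True if_False)
  qed
  ultimately show ?thesis by (simp add: TSSCPP_def)
qed

lemma diagonal_length_partition_of:
  assumes "1 \<le> u" "1 \<le> v" "v \<le> n"
  shows "diagonal_length n (partition_of n d) u v = d u v"
proof -
  have "(n + s, n + s + (u - 1), n + 1 - v) \<in> partition_of n d \<longleftrightarrow> s \<le> d u v"
    if s: "1 \<le> s" "s \<le> n" for s
  proof -
    \<comment> \<open>Since \<open>d u v \<le> v - u\<close>, the box does not cut the diagonal
      short.\<close>
    have "s + (u - 1) \<le> n" if "s \<le> d u v"
      using that s assms diagonal_array_le[of v u] diagonal_array_zero[of v u] by (cases "u \<le> v") auto
    then show ?thesis
      using s assms by (auto simp: partition_of_def centre_dist_def below_def Let_def)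
  qed
  then have "{s \<in> {1..n}. (n + s, n + s + (u - 1), n + 1 - v) \<in> partition_of n d} = {1..min n (d u v)}"
    by auto
  moreover have "d u v \<le> n"
    using assms diagonal_array_le[of v u] diagonal_array_zero[of v u] by (cases "u \<le> v") auto
  ultimately show ?thesis by (simp add: diagonal_length_def)
qed

end

section \<open>From partitions to diagonal arrays\<close>

lemma TSSCPP_down:
  "\<pi> \<in> TSSCPP n \<Longrightarrow> (i, j, k) \<in> \<pi> \<Longrightarrow> 1 \<le> i' \<Longrightarrow> i' \<le> i \<Longrightarrow> 1 \<le> j' \<Longrightarrow> j' \<le> j \<Longrightarrow>
    1 \<le> k' \<Longrightarrow> k' \<le> k \<Longrightarrow> (i', j', k') \<in> \<pi>"
  unfolding TSSCPP_def plane_partition_in_box_def by blast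

lemma TSSCPP_box:
  "\<pi> \<in> TSSCPP n \<Longrightarrow> (i, j, k) \<in> \<pi> \<Longrightarrow> i \<in> {1..2*n} \<and> j \<in> {1..2*n} \<and> k \<in> {1..2*n}"
  unfolding TSSCPP_def plane_partition_in_box_def by blast

lemma TSSCPP_symmetric:
  assumes "\<pi> \<in> TSSCPP n"
  shows "(i, j, k) \<in> \<pi> \<longleftrightarrow> (i, k, j) \<in> \<pi>" "(i, j, k) \<in> \<pi> \<longleftrightarrow> (j, i, k) \<in> \<pi>"
  using assms unfolding TSSCPP_def totally_symmetric_def by blast+

lemma TSSCPP_complement:
  "\<pi> \<in> TSSCPP n \<Longrightarrow> i \<in> {1..2*n} \<Longrightarrow> j \<in> {1..2*n} \<Longrightarrow> k \<in> {1..2*n} \<Longrightarrow>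
    (i, j, k) \<in> \<pi> \<longleftrightarrow> (2*n + 1 - i, 2*n + 1 - j, 2*n + 1 - k) \<notin> \<pi>"
  unfolding TSSCPP_def self_complementary_def by blast

lemma down_closed_eq_atLeastAtMost:
  fixes A :: "nat set"
  assumes "A \<subseteq> {1..n}" "\<And>s t. t \<in> A \<Longrightarrow> 1 \<le> s \<Longrightarrow> s \<le> t \<Longrightarrow> s \<in> A"
  shows "A = {1..card A}"
proof (cases "A = {}")
  case False
  have "finite A" using assms(1) finite_subset by blast
  then have "Max A \<in> A" "\<forall>a\<in>A. a \<le> Max A" using False by auto
  then have "s \<in> A \<longleftrightarrow> s \<in> {1..Max A}" for s
    using assms(1) assms(2)[of "Max A" s] by auto
  then have "A = {1..Max A}" by blast
  then show ?thesis by (metis card_atLeastAtMost diff_Suc_1)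
qed simp

context
  fixes n :: nat and \<pi> :: "(nat \<times> nat \<times> nat) set"
  assumes \<pi>: "\<pi> \<in> TSSCPP n"
begin

lemma TSSCPP_mem_iff_le_diagonal_length:
  assumes "1 \<le> s"
  shows "(n + s, n + s + (u - 1), n + 1 - v) \<in> \<pi> \<longleftrightarrow> s \<le> diagonal_length n \<pi> u v"
proof -
  let ?A = "{s \<in> {1..n}. (n + s, n + s + (u - 1), n + 1 - v) \<in> \<pi>}"
  have "?A = {1..card ?A}"
  proof (rule down_closed_eq_atLeastAtMost)
    fix s t assume "t \<in> ?A" "1 \<le> s" "s \<le> t"
    \<comment> \<open>A member has positive height, so \<open>n + 1 - v\<close> is not truncated to
      0.\<close>
    moreover then have "1 \<le> n + 1 - v" using TSSCPP_box[OF \<pi>] by fastforce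
    ultimately show "s \<in> ?A"
      using TSSCPP_down[OF \<pi>, of "n + t" "n + t + (u - 1)" "n + 1 - v" "n + s" "n + s + (u - 1)" "n + 1 - v"]
      by auto
  qed auto
  then have "s \<in> ?A \<longleftrightarrow> s \<in> {1..card ?A}" by simp
  moreover have "s \<in> ?A \<longleftrightarrow> (n + s, n + s + (u - 1), n + 1 - v) \<in> \<pi>"
    using TSSCPP_box[OF \<pi>] assms by fastforce
  ultimately show ?thesis using assms by (simp add: diagonal_length_def)
qed

text \<open>For \<open>i \<le> j\<close> the point is number \<open>i - n\<close> on the diagonal
  with offset \<open>j - i\<close>; symmetry reduces to this order.\<close>

lemma TSSCPP_mem_two_large:
  assumes "n < i" "n < j" "k \<le> n" "1 \<le> k"
  shows "(i, j, k) \<in> \<pi> \<longleftrightarrow>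
    below (diagonal_length n \<pi>) (centre_dist n i) (centre_dist n j) (centre_dist n k)"
proof -
  have *: "(i, j, k) \<in> \<pi> \<longleftrightarrow>
      below (diagonal_length n \<pi>) (centre_dist n i) (centre_dist n j) (centre_dist n k)"
    if "n < i" "i \<le> j" for i j
    using that assms TSSCPP_mem_iff_le_diagonal_length[of "i - n" "Suc (j - i)" "n + 1 - k"]
    by (simp add: below_def centre_dist_def)
  show ?thesis
    using assms *[of i j] *[of j i] TSSCPP_symmetric(2)[OF \<pi>] below_commute nat_le_linear by metis
qed

lemma TSSCPP_mem_one_large:
  assumes "i \<in> {1..n}" "j \<in> {1..n}" "k \<in> {n+1..2*n}"
  shows "(i, j, k) \<in> \<pi> \<longleftrightarrow>
    \<not> below (diagonal_length n \<pi>) (centre_dist n i) (centre_dist n j) (centre_dist n k)"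
proof -
  have "i \<in> {1..2*n}" "j \<in> {1..2*n}" "k \<in> {1..2*n}" using assms by auto
  moreover have "n < 2*n + 1 - i" "n < 2*n + 1 - j" "2*n + 1 - k \<le> n" "1 \<le> 2*n + 1 - k"
    using assms by auto
  ultimately show ?thesis
    using TSSCPP_complement[OF \<pi>] TSSCPP_mem_two_large centre_dist_complement by presburger
qed

text \<open>Otherwise the central point \<open>(n + 1, n + 1, n + 1)\<close> and, below it, its
  complement \<open>(n, n, n)\<close> would both be members.\<close>

lemma TSSCPP_not_mem_large:
  assumes "n < i" "n < j" "n < k"
  shows "(i, j, k) \<notin> \<pi>"
proof
  assume "(i, j, k) \<in> \<pi>"
  then have *: "(n + 1, n + 1, n + 1) \<in> \<pi>"
    by (rule TSSCPP_down[OF \<pi>]) (use assms in auto)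
  then have "1 \<le> n" using TSSCPP_box[OF \<pi>] by fastforce
  then have "(n, n, n) \<in> \<pi>" by (intro TSSCPP_down[OF \<pi> *]) auto
  then show False using * \<open>1 \<le> n\<close> TSSCPP_complement[OF \<pi>, of n n n] by simp
qed

lemma TSSCPP_mem_small:
  assumes "i \<in> {1..n}" "j \<in> {1..n}" "k \<in> {1..n}"
  shows "(i, j, k) \<in> \<pi>"
proof -
  have "i \<in> {1..2*n}" "j \<in> {1..2*n}" "k \<in> {1..2*n}" using assms by auto
  moreover have "n < 2*n + 1 - i" "n < 2*n + 1 - j" "n < 2*n + 1 - k"
    using assms by auto
  ultimately show ?thesis using TSSCPP_complement[OF \<pi>] TSSCPP_not_mem_large by blast
qed

lemma diagonal_array_diagonal_length: "diagonal_array n (diagonal_length n \<pi>)"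
  unfolding diagonal_array_def
proof (intro allI impI)
  fix u v :: nat
  let ?D = "diagonal_length n \<pi>"
  assume uv: "1 \<le> u \<and> 1 \<le> v \<and> v \<le> n"
  have le: "a \<le> b" if "\<And>s. 1 \<le> s \<Longrightarrow> s \<le> a \<Longrightarrow> s \<le> b" for a b :: nat
    using that[of a] by (cases "a = 0") auto
  have "?D (Suc u) v \<le> ?D u v"
  proof (rule le)
    fix s assume s: "1 \<le> s" "s \<le> ?D (Suc u) v"
    then have "(n + s, n + s + u, n + 1 - v) \<in> \<pi>"
      using TSSCPP_mem_iff_le_diagonal_length[of s "Suc u" v] by simp
    then have "(n + s, n + s + (u - 1), n + 1 - v) \<in> \<pi>"
      by (rule TSSCPP_down[OF \<pi>]) (use uv s in auto)
    then show "s \<le> ?D u v" using TSSCPP_mem_iff_le_diagonal_length s by simp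
  qed
  \<comment> \<open>Lowering the first coordinate of point \<open>Suc s\<close> by one gives point
    \<open>s\<close> on the next diagonal.\<close>
  moreover have "?D u v - 1 \<le> ?D (Suc u) v"
  proof (rule le)
    fix s assume s: "1 \<le> s" "s \<le> ?D u v - 1"
    then have "(n + Suc s, n + Suc s + (u - 1), n + 1 - v) \<in> \<pi>"
      using TSSCPP_mem_iff_le_diagonal_length[of "Suc s" u v] by simp
    then have "(n + s, n + s + (Suc u - 1), n + 1 - v) \<in> \<pi>"
      by (rule TSSCPP_down[OF \<pi>]) (use uv s in auto)
    then show "s \<le> ?D (Suc u) v" using TSSCPP_mem_iff_le_diagonal_length s by blast
  qed
  \<comment> \<open>A nonempty diagonal would yield \<open>(n + 1, n + v, n + 1 - v)\<close>.
    Lowering its first coordinate to \<open>n\<close> gives a permutation of its own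
    complement.\<close>
  moreover have "?D u v = 0" if "v \<le> u"
  proof (rule ccontr)
    assume "?D u v \<noteq> 0"
    then have "(n + 1, n + 1 + (u - 1), n + 1 - v) \<in> \<pi>"
      using TSSCPP_mem_iff_le_diagonal_length[of 1 u v] by simp
    then have *: "(n + 1, n + v, n + 1 - v) \<in> \<pi>"
      by (rule TSSCPP_down[OF \<pi>]) (use uv that in auto)
    then have "(n, n + v, n + 1 - v) \<in> \<pi>"
      by (rule TSSCPP_down[OF \<pi>]) (use uv in auto)
    then have "(n, n + 1 - v, n + v) \<in> \<pi>" using TSSCPP_symmetric[OF \<pi>] by blast
    moreover have "n + 1 \<in> {1..2*n}" "n + v \<in> {1..2*n}" "n + 1 - v \<in> {1..2*n}"
      using uv by auto
    moreover have "2*n + 1 - (n + 1) = n" "2*n + 1 - (n + v) = n + 1 - v"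
      "2*n + 1 - (n + 1 - v) = n + v"
      using uv by auto
    ultimately show False using * TSSCPP_complement[OF \<pi>] by metis
  qed
  moreover have "?D u v \<le> ?D u (Suc v)" if "Suc v \<le> n"
  proof (rule le)
    fix s assume s: "1 \<le> s" "s \<le> ?D u v"
    then have "(n + s, n + s + (u - 1), n + 1 - v) \<in> \<pi>"
      using TSSCPP_mem_iff_le_diagonal_length by simp
    then have "(n + s, n + s + (u - 1), n + 1 - Suc v) \<in> \<pi>"
      by (rule TSSCPP_down[OF \<pi>]) (use that s in auto)
    then show "s \<le> ?D u (Suc v)" using TSSCPP_mem_iff_le_diagonal_length s by blast
  qed
  ultimately show "?D (Suc u) v \<le> ?D u v \<and> ?D u v \<le> Suc (?D (Suc u) v) \<and>
      (v \<le> u \<longrightarrow> ?D u v = 0) \<and> (Suc v \<le> n \<longrightarrow> ?D u v \<le> ?D u (Suc v))"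
    by auto
qed

lemma partition_of_diagonal_length: "partition_of n (diagonal_length n \<pi>) = \<pi>"
proof -
  have "(i, j, k) \<in> partition_of n (diagonal_length n \<pi>) \<longleftrightarrow> (i, j, k) \<in> \<pi>" for i j k
  proof (cases "i \<in> {1..2*n} \<and> j \<in> {1..2*n} \<and> k \<in> {1..2*n}")
    case False
    then show ?thesis using TSSCPP_box[OF \<pi>, of i j k] by (auto simp: partition_of_def)
  next
    case True
    note sym = TSSCPP_symmetric[OF \<pi>]
    \<comment> \<open>In each pattern of large coordinates, symmetry moves the coordinate on the
      minority side to the last place.\<close>
    consider "i \<le> n" "j \<le> n" "k \<le> n" | "i \<le> n" "j \<le> n" "n < k" | "i \<le> n" "n < j" "k \<le> n"
      | "i \<le> n" "n < j" "n < k" | "n < i" "j \<le> n" "k \<le> n" | "n < i" "j \<le> n" "n < k"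
      | "n < i" "n < j" "k \<le> n" | "n < i" "n < j" "n < k"
      by linarith
    then show ?thesis
    proof cases
      case 1
      then show ?thesis using True TSSCPP_mem_small[of i j k] by (simp add: partition_of_def Let_def)
    next
      case 2
      then show ?thesis using True TSSCPP_mem_one_large[of i j k] by (simp add: partition_of_def Let_def)
    next
      case 3
      then show ?thesis
        using True TSSCPP_mem_one_large[of i k j] sym(1)[of i j k] by (simp add: partition_of_def Let_def)
    next
      case 4
      then show ?thesis
        using True TSSCPP_mem_two_large[of j k i] sym(2)[of i j k] sym(1)[of j i k]
        by (simp add: partition_of_def Let_def)
    next
      case 5
      then show ?thesis
        using True TSSCPP_mem_one_large[of j k i] sym(2)[of i j k] sym(1)[of j i k]
        by (simp add: partition_of_def Let_def)
    next
      case 6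
      then show ?thesis
        using True TSSCPP_mem_two_large[of i k j] sym(1)[of i j k] by (simp add: partition_of_def Let_def)
    next
      case 7
      then show ?thesis using True TSSCPP_mem_two_large[of i j k] by (simp add: partition_of_def Let_def)
    next
      case 8
      then show ?thesis using True TSSCPP_not_mem_large[of i j k] by (simp add: partition_of_def Let_def)
    qed
  qed
  then show ?thesis by auto
qed

end

section \<open>Tournaments and diagonal arrays\<close>

lemma num_upsets_step:
  assumes "u < v"
  shows "num_upsets T v {u..v - 1} =
    (if T (u, v) = v then 1 else 0) + num_upsets T v {Suc u..v - 1}"
proof -
  have "{u..v - 1} = insert u {Suc u..v - 1}" using assms by auto
  moreover have "upset T v u \<longleftrightarrow> T (u, v) = v" using assms by (simp add: upset_def min_def max_def)
  ultimately have "{w \<in> {u..v - 1}. upset T v w} =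
      (if T (u, v) = v then {u} else {}) \<union> {w \<in> {Suc u..v - 1}. upset T v w}"
    by auto
  then show ?thesis by (simp add: num_upsets_def)
qed

text \<open>Column \<open>v\<close> telescopes down to \<open>d v v = 0\<close>: every strict drop
  is by exactly 1 and is recorded as one upset.\<close>

lemma num_upsets_tournament_of:
  assumes d: "diagonal_array n d" and uv: "1 \<le> u" "u \<le> v" "v \<le> n"
  shows "num_upsets (tournament_of n d) v {u..v - 1} = d u v"
  using uv(2,1)
proof (induction u rule: inc_induct)
  case base
  then show ?case using diagonal_array_zero[OF d, of v v] uv by (simp add: num_upsets_def)
next
  case (step m)
  have "tournament_of n d (m, v) = v \<longleftrightarrow> d (Suc m) v < d m v"
    using step uv by (simp add: tournament_of_def)
  moreover have "d (Suc m) v \<le> d m v \<and> d m v \<le> Suc (d (Suc m) v)"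
    using diagonal_array_step[OF d] step uv by simp
  ultimately show ?case using step num_upsets_step[of m v "tournament_of n d"] by auto
qed

lemma tournament_of_in_tournaments: "tournament_of n d \<in> tournaments n"
  by (auto simp: tournament_of_def tournaments_def split: if_splits)

lemma monotone_upsets_tournament_of:
  assumes "diagonal_array n d"
  shows "monotone_upsets n (tournament_of n d)"
  unfolding monotone_upsets_def
proof (intro allI impI)
  fix u v k
  assume uv: "1 \<le> u \<and> u < v \<and> v \<le> n" and k: "num_upsets (tournament_of n d) v {u..v - 1} = k"
  have "num_upsets (tournament_of n d) (v - 1) {u..v - 1 - 1} = d u (v - 1)"
    using uv by (intro num_upsets_tournament_of[OF assms]) auto
  moreover have "d u (v - 1) \<le> d u v" using diagonal_array_mono_right[OF assms, of "v - 1" v u] uv by fastforce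
  moreover have "v - 1 - 1 = v - 2" by simp
  ultimately show "num_upsets (tournament_of n d) (v - 1) {u..v - 2} \<le> k"
    using num_upsets_tournament_of[OF assms, of u v] uv k by simp
qed

lemma diagonal_array_num_upsets:
  assumes "monotone_upsets n T"
  shows "diagonal_array n (\<lambda>u v. num_upsets T v {u..v - 1})"
  unfolding diagonal_array_def
proof (intro allI impI)
  fix u v :: nat
  let ?S = "\<lambda>u v. num_upsets T v {u..v - 1}"
  assume uv: "1 \<le> u \<and> 1 \<le> v \<and> v \<le> n"
  have zero: "?S u v = 0" if "v \<le> u" for u
    using that uv by (auto simp: num_upsets_def)
  have "?S (Suc u) v \<le> ?S u v \<and> ?S u v \<le> Suc (?S (Suc u) v)"
    using num_upsets_step[of u v T] zero[of u] zero[of "Suc u"] by (cases "u < v") auto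
  \<comment> \<open>This is the tournament condition for the vertex \<open>Suc v\<close>.\<close>
  moreover have "?S u v \<le> ?S u (Suc v)" if "Suc v \<le> n"
  proof (cases "u < Suc v")
    case True
    have "num_upsets T (Suc v - 1) {u..Suc v - 2} \<le> ?S u (Suc v)"
      using assms True that uv unfolding monotone_upsets_def by blast
    moreover have "Suc v - 2 = v - 1" by simp
    ultimately show ?thesis by simp
  next
    case False
    then show ?thesis using zero[of u] by simp
  qed
  ultimately show "?S (Suc u) v \<le> ?S u v \<and> ?S u v \<le> Suc (?S (Suc u) v) \<and>
      (v \<le> u \<longrightarrow> ?S u v = 0) \<and> (Suc v \<le> n \<longrightarrow> ?S u v \<le> ?S u (Suc v))"
    using zero by blast
qed

text \<open>The counts starting at \<open>u\<close> and at \<open>Suc u\<close> differ exactly when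
  \<open>v\<close> upsets \<open>u\<close>, so the counts determine every game.\<close>

lemma tournament_of_eqI:
  assumes T: "T \<in> tournaments n"
    and d: "\<And>u v. 1 \<le> u \<Longrightarrow> 1 \<le> v \<Longrightarrow> v \<le> n \<Longrightarrow> d u v = num_upsets T v {u..v - 1}"
  shows "tournament_of n d = T"
proof
  fix p :: "nat \<times> nat"
  obtain i j where p: "p = (i, j)" by (cases p)
  show "tournament_of n d p = T p"
  proof (cases "1 \<le> i \<and> i < j \<and> j \<le> n")
    case True
    then have "T (i, j) \<in> {i, j}" using T by (auto simp: tournaments_def PiE_iff)
    then show ?thesis
      using True p d[of i j] d[of "Suc i" j] num_upsets_step[of i j T]
      by (auto simp: tournament_of_def)
  next
    case False
    then show ?thesis using T p by (auto simp: tournament_of_def tournaments_def PiE_iff extensional_def)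
  qed
qed

section \<open>The bijection through arrays\<close>

lemma partition_of_cong:
  assumes "\<And>u v. 1 \<le> u \<Longrightarrow> 1 \<le> v \<Longrightarrow> v \<le> n \<Longrightarrow> d u v = d' u v"
  shows "partition_of n d = partition_of n d'"
proof -
  \<comment> \<open>Only entries with \<open>u \<ge> 1\<close> and \<open>v\<close> in
    \<open>{1..n}\<close> are read, which is where the arrays agree.\<close>
  have "below d x y (centre_dist n i) = below d' x y (centre_dist n i)" if "i \<in> {1..2*n}" for x y i
    unfolding below_def using centre_dist_bounds[OF that] assms by simp
  then have "(i, j, k) \<in> partition_of n d \<longleftrightarrow> (i, j, k) \<in> partition_of n d'" for i j k
    unfolding partition_of_def Let_def mem_Collect_eq prod.case by (simp cong: conj_cong)
  then show ?thesis by auto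
qed

theorem theorem6p6:
  fixes n :: nat
  assumes "n \<ge> 1"
  shows "\<exists>f. bij_betw f (TSSCPP n)
           {T \<in> tournaments n.
              \<forall>u v k. 1 \<le> u \<and> u < v \<and> v \<le> n \<longrightarrow>
                num_upsets T v {u..v - 1} = k \<longrightarrow> num_upsets T (v - 1) {u..v - 2} \<le> k}"
proof -
  let ?f = "\<lambda>\<pi>. tournament_of n (diagonal_length n \<pi>)"
  let ?g = "\<lambda>T. partition_of n (\<lambda>u v. num_upsets T v {u..v - 1})"
  have "bij_betw ?f (TSSCPP n) {T \<in> tournaments n. monotone_upsets n T}"
  proof (rule bij_betw_byWitness[where f' = ?g])
    show "\<forall>\<pi>\<in>TSSCPP n. ?g (?f \<pi>) = \<pi>"
    proof
      fix \<pi> assume \<pi>: "\<pi> \<in> TSSCPP n"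
      note D = diagonal_array_diagonal_length[OF \<pi>]
      have "num_upsets (?f \<pi>) v {u..v - 1} = diagonal_length n \<pi> u v"
        if "1 \<le> u" "1 \<le> v" "v \<le> n" for u v
        using that num_upsets_tournament_of[OF D, of u v] diagonal_array_zero[OF D, of v u]
        by (cases "u \<le> v") (auto simp: num_upsets_def)
      then have "?g (?f \<pi>) = partition_of n (diagonal_length n \<pi>)"
        by (rule partition_of_cong)
      then show "?g (?f \<pi>) = \<pi>" using partition_of_diagonal_length[OF \<pi>] by simp
    qed
    show "\<forall>T\<in>{T \<in> tournaments n. monotone_upsets n T}. ?f (?g T) = T"
      \<comment> \<open>The diagonal lengths of \<open>?g T\<close> are the upset counts of
        \<open>T\<close>, which determine \<open>T\<close>.\<close>
      using diagonal_length_partition_of[OF diagonal_array_num_upsets]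
      by (auto intro!: tournament_of_eqI)
    show "?f ` TSSCPP n \<subseteq> {T \<in> tournaments n. monotone_upsets n T}"
      using diagonal_array_diagonal_length tournament_of_in_tournaments
        monotone_upsets_tournament_of by blast
    show "?g ` {T \<in> tournaments n. monotone_upsets n T} \<subseteq> TSSCPP n"
      using partition_of_TSSCPP diagonal_array_num_upsets by blast
  qed
  then show ?thesis unfolding monotone_upsets_def by blast
qed

end
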